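(* Consider the crowdsourcing scheduling problem described in the context, and assume $\tau_{min} > \frac{2}{\lambda_{max}}$ and $n \geq m$. Then the LRF algorithm achieves an approximation ratio of at most $2 - \frac{1}{m}$, i.e. the total weighted completion time of its schedule is at most $\left(2-\frac{1}{m}\right)$ times the minimum total weighted completion time over all schedules.
   Context: Crowdsourcing scheduling problem: there are $m\ge 1$ crowd workers $u_1,\dots,u_m$, worker $u_j$ having a rate $\lambda_j>0$, and $n$ indivisible tasks $s_1,\dots,s_n$, task $s_i$ having required service time $\tau_i>0$ and weight $w_i>0$. A schedule partitions the tasks into disjoint sets $\mathcal{S}_1,\dots,\mathcal{S}_m$ ($\mathcal{S}_j$ is processed by $u_j$) and fixes a processing order within each $\mathcal{S}_j$; each worker processes its tasks sequentially. If $s_i\in\mathcal{S}_j$, its completion time is $C_i=\frac{2}{\lambda_j}+\sum\tau_k$, the sum over all tasks $s_k\in\mathcal{S}_j$ processed before $s_i$ together with $s_i$ itself. The total weighted completion time is $\sum_{i=1}^n w_iC_i$. $\tau_{min}=\min_i\tau_i$, $\lambda_{max}=\max_j\lambda_j$. LRF (Largest-Ratio-First) algorithm: the tasks are indexed so that $\frac{w_1}{\tau_1}\ge\cdots\ge\frac{w_n}{\tau_n}$; initialize $\mathcal{S}_j=\emptyset$ and $EW_j=\frac{2}{\lambda_j}$ for all $j$; for $i=1,\dots,n$ in turn, pick $j_{\min}=\arg\min_k EW_k$, add $s_i$ to $\mathcal{S}_{j_{\min}}$ and increase $EW_{j_{\min}}$ by $\tau_i$. Each worker processes its tasks in the order they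 were assigned. *)

theory Defs
  imports Complex_Main "HOL-Library.Disjoint_Sets"
begin

text \<open>
  Workers are numbered \<open>1..m\<close> and tasks \<open>1..n\<close>. A schedule maps each worker \<open>j\<close> to the list of
  the tasks it processes, in processing order. Outside \<open>{1..m}\<close> it is \<open>[]\<close>, so that
  there are only finitely many schedules.
\<close>

definition schedules :: "nat \<Rightarrow> nat \<Rightarrow> (nat \<Rightarrow> nat list) set" where
  "schedules m n = {S.
     (\<forall>j. j \<notin> {1..m} \<longrightarrow> S j = []) \<and>
     (\<forall>j\<in>{1..m}. distinct (S j)) \<and>
     disjoint_family_on (\<lambda>j. set (S j)) {1..m} \<and>
     (\<Union>j\<in>{1..m}. set (S j)) = {1..n}}"

definition worker_of :: "nat \<Rightarrow> (nat \<Rightarrow> nat list) \<Rightarrow> nat \<Rightarrow> nat" where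
  "worker_of m S i = (THE j. j \<in> {1..m} \<and> i \<in> set (S j))"

definition completion_time ::
  "nat \<Rightarrow> (nat \<Rightarrow> real) \<Rightarrow> (nat \<Rightarrow> real) \<Rightarrow> (nat \<Rightarrow> nat list) \<Rightarrow> nat \<Rightarrow> real" where
  "completion_time m lam tau S i =
     (let j = worker_of m S i
      in 2 / lam j + (\<Sum>k\<leftarrow>takeWhile (\<lambda>k. k \<noteq> i) (S j). tau k) + tau i)"

definition total_weighted_completion_time ::
  "nat \<Rightarrow> nat \<Rightarrow> (nat \<Rightarrow> real) \<Rightarrow> (nat \<Rightarrow> real) \<Rightarrow> (nat \<Rightarrow> real) \<Rightarrow> (nat \<Rightarrow> nat list) \<Rightarrow> real" where
  "total_weighted_completion_time m n lam tau w S =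
     (\<Sum>i=1..n. w i * completion_time m lam tau S i)"

definition min_total_weighted_completion_time ::
  "nat \<Rightarrow> nat \<Rightarrow> (nat \<Rightarrow> real) \<Rightarrow> (nat \<Rightarrow> real) \<Rightarrow> (nat \<Rightarrow> real) \<Rightarrow> real" where
  "min_total_weighted_completion_time m n lam tau w =
     Min (total_weighted_completion_time m n lam tau w ` schedules m n)"

text \<open>
  \<open>lrf_run m lam tau xs S EW\<close>: the greedy loop, having treated the tasks \<open>xs\<close> in this order,
  can be in the state given by the partial assignment \<open>S\<close> and the workloads \<open>EW\<close>.
  It is a relation because the arg-min may be attained by several workers; any of them may be
  picked.
\<close>

inductive lrf_run ::
  "nat \<Rightarrow> (nat \<Rightarrow> real) \<Rightarrow> (nat \<Rightarrow> real) \<Rightarrow> nat list \<Rightarrow> (nat \<Rightarrow> nat list) \<Rightarrow> (nat \<Rightarrow> real) \<Rightarrow> bool"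
  for m :: nat and lam tau :: "nat \<Rightarrow> real" where
  init: "lrf_run m lam tau [] (\<lambda>_. []) (\<lambda>j. 2 / lam j)"
| assign: "lrf_run m lam tau xs S EW \<Longrightarrow> is_arg_min EW (\<lambda>k. k \<in> {1..m}) j \<Longrightarrow>
    lrf_run m lam tau (xs @ [i]) (S(j := S j @ [i])) (EW(j := EW j + tau i))"

text \<open>
  The tasks may be numbered arbitrarily; LRF treats them in any order \<open>xs\<close> of non-increasing
  ratio \<open>w i / tau i\<close>, ties being broken arbitrarily.
\<close>

definition lrf_schedule ::
  "nat \<Rightarrow> nat \<Rightarrow> (nat \<Rightarrow> real) \<Rightarrow> (nat \<Rightarrow> real) \<Rightarrow> (nat \<Rightarrow> real) \<Rightarrow> (nat \<Rightarrow> nat list) \<Rightarrow> bool" where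
  "lrf_schedule m n lam tau w S \<longleftrightarrow>
     (\<exists>xs EW. distinct xs \<and> set xs = {1..n} \<and>
        sorted_wrt (\<lambda>a b. w a / tau a \<ge> w b / tau b) xs \<and>
        lrf_run m lam tau xs S EW)"

text \<open>
  LRF always yields a schedule, and the minimum is taken over a finite nonempty set.
\<close>

lemma finite_schedules: "finite (schedules m n)"
proof -
  let ?B = "{xs :: nat list. set xs \<subseteq> {1..n} \<and> length xs \<le> n}"
  have "S j \<in> ?B" if "S \<in> schedules m n" "j \<in> {1..m}" for S j
  proof -
    have s: "set (S j) \<subseteq> {1..n}" and d: "distinct (S j)"
      using that by (auto simp: schedules_def)
    have "length (S j) \<le> n"
      using card_mono[OF _ s] distinct_card[OF d] by simp
    with s show ?thesis by simp
  qed
  then have "schedules m n \<subseteq>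
      {S. \<forall>j. (j \<in> {1..m} \<longrightarrow> S j \<in> ?B) \<and> (j \<notin> {1..m} \<longrightarrow> S j = [])}"
    by (auto simp: schedules_def)
  moreover have "finite \<dots>"
    by (intro finite_set_of_finite_funs finite_lists_length_le) simp_all
  ultimately show ?thesis by (rule finite_subset)
qed

lemma lrf_run_invariant:
  assumes "lrf_run m lam tau xs S EW" "distinct xs"
  shows "(\<forall>j. j \<notin> {1..m} \<longrightarrow> S j = []) \<and> (\<forall>j. distinct (S j)) \<and>
    disjoint_family_on (\<lambda>j. set (S j)) {1..m} \<and> (\<Union>j\<in>{1..m}. set (S j)) = set xs"
  using assms
proof (induction rule: lrf_run.induct)
  case init
  then show ?case by (simp add: disjoint_family_on_def)
next
  case (assign xs S EW j i)
  have j: "j \<in> {1..m}" using assign.hyps(2) by (simp add: is_arg_min_def)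
  have IH: "\<forall>j. j \<notin> {1..m} \<longrightarrow> S j = []" "\<forall>j. distinct (S j)"
    "disjoint_family_on (\<lambda>j. set (S j)) {1..m}" "(\<Union>j\<in>{1..m}. set (S j)) = set xs"
    using assign.IH assign.prems by simp_all
  have new: "i \<notin> set (S k)" for k
    using IH(1,4) assign.prems by (cases "k \<in> {1..m}") auto
  have "(\<Union>k\<in>{1..m}. set ((S(j := S j @ [i])) k)) = insert i (\<Union>k\<in>{1..m}. set (S k))"
    using j by (auto split: if_splits)
  moreover have "disjoint_family_on (\<lambda>k. set ((S(j := S j @ [i])) k)) {1..m}"
    using IH(3) new by (fastforce simp: disjoint_family_on_def)
  ultimately show ?case using IH new j by auto
qed

lemma lrf_schedule_in_schedules: "lrf_schedule m n lam tau w S \<Longrightarrow> S \<in> schedules m n"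
  using lrf_run_invariant unfolding lrf_schedule_def schedules_def by blast

lemma lrf_run_exists:
  assumes "m \<ge> 1"
  shows "\<exists>S EW. lrf_run m lam tau xs S EW"
proof (induction xs rule: rev_induct)
  case Nil
  show ?case using lrf_run.init by blast
next
  case (snoc i xs)
  then obtain S EW where "lrf_run m lam tau xs S EW" by blast
  moreover obtain j where "is_arg_min EW (\<lambda>k. k \<in> {1..m}) j"
    using ex_is_arg_min_if_finite[of "{1..m}" EW] assms by auto
  ultimately show ?case using lrf_run.assign by blast
qed

lemma lrf_schedule_exists:
  assumes "m \<ge> 1"
  shows "\<exists>S. lrf_schedule m n lam tau w S"
proof -
  define xs where "xs = sort_key (\<lambda>i. - (w i / tau i)) [1..<Suc n]"
  have "distinct xs" "set xs = {1..n}" by (auto simp: xs_def)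
  moreover have "sorted_wrt (\<lambda>a b. w a / tau a \<ge> w b / tau b) xs"
    using sorted_sort_key[of "\<lambda>i. - (w i / tau i)" "[1..<Suc n]"]
    by (simp add: xs_def sorted_map)
  ultimately show ?thesis
    using lrf_run_exists[OF assms] unfolding lrf_schedule_def by blast
qed

lemma schedules_nonempty: "m \<ge> 1 \<Longrightarrow> schedules m n \<noteq> {}"
  using lrf_schedule_exists lrf_schedule_in_schedules by blast

end

theory Submission
  imports Defs "HOL-Analysis.Convex"
begin

text \<open>
  Put \<open>r\<^sub>j = 2 / lam j\<close>. Since \<open>w i = (w i / tau i) * tau i\<close> with non-increasing ratios, summation by
  parts reduces the comparison of LRF with a schedule \<open>T\<close> to the weights \<open>tau i\<close>, restricted to the
  set \<open>A\<close> of the first tasks treated by LRF. For these weights the order on a worker does not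
  matter: the cost of \<open>A\<close> is \<open>(\<Sum>\<^sub>j ((r\<^sub>j + L\<^sub>j)\<^sup>2 - r\<^sub>j\<^sup>2) + \<Sum>\<^sub>A tau\<^sup>2) / 2\<close> for the loads \<open>L\<^sub>j\<close> that
  \<open>A\<close> puts on the workers, and the tasks outside \<open>A\<close> can only increase it. The greedy workloads
  are balanced up to the last task on each worker, so their sum of squares exceeds that of any
  other distribution by at most \<open>(1 - 1/m) \<Sum>\<^sub>A tau\<^sup>2\<close>. Hence the LRF cost exceeds the optimum by at
  most \<open>(1 - 1/m) / 2 * \<Sum> w tau\<close>, and \<open>\<Sum> w tau\<close> is itself at most the optimum: this gives the
  ratio \<open>3/2 - 1/(2m)\<close>.
\<close>

section \<open>Inequalities for finite sums of reals\<close>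

lemma sum_power2_le_power2_sum:
  fixes f :: "'a \<Rightarrow> real"
  assumes "finite A" "\<And>x. x \<in> A \<Longrightarrow> 0 \<le> f x"
  shows "(\<Sum>x\<in>A. (f x)\<^sup>2) \<le> (\<Sum>x\<in>A. f x)\<^sup>2"
  using assms
proof (induction A rule: finite_induct)
  case empty
  then show ?case by simp
next
  case (insert a A)
  have "0 \<le> f a * sum f A" using insert.prems by (intro mult_nonneg_nonneg sum_nonneg) auto
  then show ?case using insert by (simp add: power2_sum)
qed

text \<open>Write \<open>y = E + d\<close> with \<open>\<Sum> d = 0\<close>. Then \<open>\<Sum> y^2
  - \<Sum> E^2 = \<Sum> (2 * (E j - E k) * d j + d j^2)\<close>, and completing the square bounds
  this below by \<open>\<Sum> (d + a)^2 - \<Sum> a^2\<close>. Cauchy-Schwarz together with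
  \<open>a \<ge> 0\<close> gives
  \<open>\<Sum> (d + a)^2 \<ge> (\<Sum> a)^2 / N \<ge> \<Sum> a^2 / N\<close>, which is where the
  \<open>1 / card J\<close> is gained.\<close>

lemma sum_power2_near_balanced:
  fixes E y p :: "'a \<Rightarrow> real"
  assumes J: "finite J" "k \<in> J" and B: "B \<subseteq> J"
    and tot: "(\<Sum>j\<in>J. E j) = (\<Sum>j\<in>J. y j)"
    and low: "\<And>j. j \<in> J \<Longrightarrow> E k \<le> E j"
    and fixd: "\<And>j. j \<in> J - B \<Longrightarrow> E j \<le> y j"
    and near: "\<And>j. j \<in> B \<Longrightarrow> E j - p j \<le> E k"
  shows "(\<Sum>j\<in>J. (E j)\<^sup>2)
    \<le> (\<Sum>j\<in>J. (y j)\<^sup>2) + (1 - 1 / real (card J)) * (\<Sum>j\<in>B. (p j)\<^sup>2)"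
proof -
  \<comment> \<open>The excess over the minimum is cut to 0 outside \<open>B\<close>, since
    \<open>p\<close> bounds it only on \<open>B\<close>.\<close>
  define a where "a j = (if j \<in> B then E j - E k else 0)" for j
  define d where "d j = y j - E j" for j
  define N where "N = real (card J)"
  have N: "N \<ge> 1" using J by (auto simp: N_def Suc_le_eq card_gt_0_iff)
  have d0: "(\<Sum>j\<in>J. d j) = 0" using tot by (simp add: d_def sum_subtractf)
  have a0: "a j \<ge> 0" if "j \<in> J" for j using low that by (simp add: a_def)
  have "(\<Sum>j\<in>J. (a j)\<^sup>2) \<le> (\<Sum>j\<in>J. a j)\<^sup>2"
    using J a0 by (intro sum_power2_le_power2_sum)
  also have "\<dots> = (\<Sum>j\<in>J. d j + a j)\<^sup>2" by (simp add: sum.distrib d0)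
  also have "\<dots> \<le> (\<Sum>j\<in>J. (d j + a j)\<^sup>2) * N"
    unfolding N_def by (rule sum_squared_le_sum_of_squares)
  finally have cs: "(\<Sum>j\<in>J. (a j)\<^sup>2) / N \<le> (\<Sum>j\<in>J. (d j + a j)\<^sup>2)"
    using N by (simp add: field_simps)
  have "(d j + a j)\<^sup>2 \<le> (y j)\<^sup>2 - (E j)\<^sup>2 - 2 * E k * d j + (a j)\<^sup>2" if "j \<in> J" for j
  proof -
    \<comment> \<open>Equality on \<open>B\<close>. Outside \<open>B\<close> the left side is 0 and
      both factors on the right are nonnegative, by \<open>fixd\<close> and
      \<open>low\<close>.\<close>
    have "a j * d j \<le> (E j - E k) * d j"
      using fixd[of j] low[OF that] that by (auto simp: a_def d_def)
    then show ?thesis by (simp add: d_def power2_eq_square algebra_simps)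
  qed
  then have "(\<Sum>j\<in>J. (d j + a j)\<^sup>2)
      \<le> (\<Sum>j\<in>J. (y j)\<^sup>2 - (E j)\<^sup>2 - 2 * E k * d j + (a j)\<^sup>2)"
    by (rule sum_mono)
  also have "\<dots> = (\<Sum>j\<in>J. (y j)\<^sup>2) - (\<Sum>j\<in>J. (E j)\<^sup>2) + (\<Sum>j\<in>J. (a j)\<^sup>2)"
    by (simp add: sum.distrib sum_subtractf d0 flip: sum_distrib_left)
  finally have "(\<Sum>j\<in>J. (E j)\<^sup>2) \<le> (\<Sum>j\<in>J. (y j)\<^sup>2) + (1 - 1 / N) * (\<Sum>j\<in>J. (a j)\<^sup>2)"
    using cs by (simp add: algebra_simps)
  moreover have "(\<Sum>j\<in>J. (a j)\<^sup>2) \<le> (\<Sum>j\<in>B. (p j)\<^sup>2)"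
  proof -
    have "(\<Sum>j\<in>J. (a j)\<^sup>2) = (\<Sum>j\<in>B. (a j)\<^sup>2)"
      using J B by (intro sum.mono_neutral_right) (auto simp: a_def)
    also have "\<dots> \<le> (\<Sum>j\<in>B. (p j)\<^sup>2)"
    proof (intro sum_mono power_mono)
      show "a j \<le> p j" "0 \<le> a j" if "j \<in> B" for j
        using near[OF that] a0[of j] B that by (auto simp: a_def)
    qed
    finally show ?thesis .
  qed
  moreover have "0 \<le> 1 - 1 / N" using N by simp
  ultimately show ?thesis
    unfolding N_def using mult_left_mono by (smt (verit, best))
qed

text \<open>Summation by parts, phrased as an induction. The lower bound \<open>c\<close> is kept
  general so that the hypothesis for \<open>xs\<close> can be used with the ratio of the next
  element; \<open>c = 0\<close> gives nonnegativity.\<close>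

lemma weighted_sum_nonneg_of_prefix_sums:
  fixes \<rho> g :: "'a \<Rightarrow> real"
  assumes "sorted_wrt (\<lambda>a b. \<rho> b \<le> \<rho> a) xs"
    and "\<And>ys zs. xs = ys @ zs \<Longrightarrow> 0 \<le> (\<Sum>i\<leftarrow>ys. g i)"
    and "\<And>i. i \<in> set xs \<Longrightarrow> c \<le> \<rho> i"
  shows "c * (\<Sum>i\<leftarrow>xs. g i) \<le> (\<Sum>i\<leftarrow>xs. \<rho> i * g i)"
  using assms
proof (induction xs arbitrary: c rule: rev_induct)
  case Nil
  then show ?case by simp
next
  case (snoc x xs)
  have "\<rho> x * (\<Sum>i\<leftarrow>xs. g i) \<le> (\<Sum>i\<leftarrow>xs. \<rho> i * g i)"
    using snoc.prems by (intro snoc.IH) (auto simp: sorted_wrt_append)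
  moreover have "c * (\<Sum>i\<leftarrow>xs @ [x]. g i) \<le> \<rho> x * (\<Sum>i\<leftarrow>xs @ [x]. g i)"
    using snoc.prems(2)[of "xs @ [x]" "[]"] snoc.prems(3)[of x] by (intro mult_right_mono) auto
  ultimately show ?case by (simp add: algebra_simps)
qed

section \<open>The cost of one worker under the weights \<open>tau\<close>\<close>

text \<open>Appending a task of length \<open>t\<close> behind workload \<open>X\<close> costs
  \<open>t * (X + t) = ((X + t)^2 - X^2 + t^2) / 2\<close>, so the squares telescope and the order
  drops out.\<close>

lemma sum_tau_finish_times:
  fixes tau :: "'a \<Rightarrow> real"
  assumes "distinct xs"
  shows "(\<Sum>i\<in>set xs. tau i * (r + (\<Sum>k\<leftarrow>takeWhile (\<lambda>k. k \<noteq> i) xs. tau k) + tau i))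
    = ((r + (\<Sum>i\<in>set xs. tau i))\<^sup>2 - r\<^sup>2 + (\<Sum>i\<in>set xs. (tau i)\<^sup>2)) / 2"
  using assms
proof (induction xs rule: rev_induct)
  case Nil
  then show ?case by simp
next
  case (snoc x xs)
  have old: "takeWhile (\<lambda>k. k \<noteq> i) (xs @ [x]) = takeWhile (\<lambda>k. k \<noteq> i) xs" if "i \<in> set xs" for i
    using that by (intro takeWhile_append1) auto
  have new: "takeWhile (\<lambda>k. k \<noteq> x) (xs @ [x]) = xs"
    using snoc.prems by (subst takeWhile_append2) auto
  have x: "x \<notin> set xs" and d: "distinct xs" using snoc.prems by auto
  have "(\<Sum>k\<leftarrow>xs. tau k) = (\<Sum>k\<in>set xs. tau k)" using d by (simp add: sum_list_distinct_conv_sum_set)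
  moreover have "(\<Sum>i\<in>set xs. tau i * (r + (\<Sum>k\<leftarrow>takeWhile (\<lambda>k. k \<noteq> i) (xs @ [x]). tau k) + tau i))
    = (\<Sum>i\<in>set xs. tau i * (r + (\<Sum>k\<leftarrow>takeWhile (\<lambda>k. k \<noteq> i) xs. tau k) + tau i))"
    by (intro sum.cong) (simp_all only: old)
  ultimately show ?case
    using x snoc.IH[OF d] new by (simp add: power2_eq_square algebra_simps add_divide_distrib)
qed

lemma sum_list_takeWhile_filter_le:
  fixes tau :: "'a \<Rightarrow> real"
  assumes "\<And>k. k \<in> set xs \<Longrightarrow> 0 \<le> tau k" "P i"
  shows "(\<Sum>k\<leftarrow>takeWhile (\<lambda>k. k \<noteq> i) (filter P xs). tau k) \<le> (\<Sum>k\<leftarrow>takeWhile (\<lambda>k. k \<noteq> i) xs. tau k)"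
  using assms
proof (induction xs)
  case (Cons x xs)
  have "0 \<le> (\<Sum>k\<leftarrow>takeWhile (\<lambda>k. k \<noteq> i) xs. tau k)"
    using Cons.prems by (intro sum_list_nonneg) (auto dest: set_takeWhileD)
  then show ?case using Cons by (auto simp: add_increasing)
qed simp

text \<open>Deleting the tasks outside \<open>A\<close> lets no remaining task finish later, and the
  exact formula applies to the filtered list.\<close>

lemma sum_tau_finish_times_ge:
  fixes tau :: "'a \<Rightarrow> real"
  assumes "distinct xs" and pos: "\<And>k. k \<in> set xs \<Longrightarrow> 0 \<le> tau k"
  shows "((r + (\<Sum>i\<in>A \<inter> set xs. tau i))\<^sup>2 - r\<^sup>2 + (\<Sum>i\<in>A \<inter> set xs. (tau i)\<^sup>2)) / 2
    \<le> (\<Sum>i\<in>A \<inter> set xs. tau i * (r + (\<Sum>k\<leftarrow>takeWhile (\<lambda>k. k \<noteq> i) xs. tau k) + tau i))"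
proof -
  let ?ys = "filter (\<lambda>k. k \<in> A) xs"
  have s: "set ?ys = A \<inter> set xs" by auto
  have "(\<Sum>i\<in>A \<inter> set xs. tau i * (r + (\<Sum>k\<leftarrow>takeWhile (\<lambda>k. k \<noteq> i) ?ys. tau k) + tau i))
    \<le> (\<Sum>i\<in>A \<inter> set xs. tau i * (r + (\<Sum>k\<leftarrow>takeWhile (\<lambda>k. k \<noteq> i) xs. tau k) + tau i))"
    using pos
    by (intro sum_mono mult_left_mono add_right_mono add_left_mono sum_list_takeWhile_filter_le) auto
  then show ?thesis
    using sum_tau_finish_times[of ?ys tau r] assms(1) unfolding s by simp
qed

section \<open>The cost of a whole schedule under the weights \<open>tau\<close>\<close>

lemma completion_time_eq:
  assumes "disjoint_family_on (\<lambda>j. set (S j)) {1..m}" "j \<in> {1..m}" "i \<in> set (S j)"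
  shows "completion_time m lam tau S i
    = 2 / lam j + (\<Sum>k\<leftarrow>takeWhile (\<lambda>k. k \<noteq> i) (S j). tau k) + tau i"
proof -
  have "worker_of m S i = j"
    unfolding worker_of_def using assms by (intro the_equality) (fastforce simp: disjoint_family_on_def)+
  then show ?thesis by (simp add: completion_time_def)
qed

lemma sum_over_workers:
  fixes f :: "'a \<Rightarrow> real" and m :: nat
  assumes "disjoint_family_on (\<lambda>j. set (S j)) {1..m}" "A \<subseteq> (\<Union>j\<in>{1..m}. set (S j))"
  shows "(\<Sum>i\<in>A. f i) = (\<Sum>j\<in>{1..m}. \<Sum>i\<in>A \<inter> set (S j). f i)"
proof -
  have "A = (\<Union>j\<in>{1..m}. A \<inter> set (S j))" using assms(2) by auto
  then have "(\<Sum>i\<in>A. f i) = (\<Sum>i\<in>(\<Union>j\<in>{1..m}. A \<inter> set (S j)). f i)" by simp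
  also have "\<dots> = (\<Sum>j\<in>{1..m}. \<Sum>i\<in>A \<inter> set (S j). f i)"
  proof (rule sum.UNION_disjoint)
    show "\<forall>i\<in>{1..m}. \<forall>j\<in>{1..m}. i \<noteq> j \<longrightarrow> A \<inter> set (S i) \<inter> (A \<inter> set (S j)) = {}"
      using assms(1) unfolding disjoint_family_on_def by blast
  qed simp_all
  finally show ?thesis .
qed

lemma schedule_sum_tau_completion_ge:
  assumes dj: "disjoint_family_on (\<lambda>j. set (S j)) {1..m}" and A: "A \<subseteq> (\<Union>j\<in>{1..m}. set (S j))"
    and dist: "\<And>j. j \<in> {1..m} \<Longrightarrow> distinct (S j)"
    and pos: "\<And>j k. j \<in> {1..m} \<Longrightarrow> k \<in> set (S j) \<Longrightarrow> 0 \<le> tau k"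
  shows "((\<Sum>j\<in>{1..m}. (2 / lam j + (\<Sum>i\<in>A \<inter> set (S j). tau i))\<^sup>2 - (2 / lam j)\<^sup>2)
      + (\<Sum>i\<in>A. (tau i)\<^sup>2)) / 2
    \<le> (\<Sum>i\<in>A. tau i * completion_time m lam tau S i)"
proof -
  have "((\<Sum>j\<in>{1..m}. (2 / lam j + (\<Sum>i\<in>A \<inter> set (S j). tau i))\<^sup>2 - (2 / lam j)\<^sup>2)
      + (\<Sum>i\<in>A. (tau i)\<^sup>2)) / 2
    = (\<Sum>j\<in>{1..m}. ((2 / lam j + (\<Sum>i\<in>A \<inter> set (S j). tau i))\<^sup>2 - (2 / lam j)\<^sup>2
        + (\<Sum>i\<in>A \<inter> set (S j). (tau i)\<^sup>2)) / 2)"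
    by (simp only: sum_over_workers[OF dj A] sum.distrib flip: sum_divide_distrib)
  also have "\<dots> \<le> (\<Sum>j\<in>{1..m}. \<Sum>i\<in>A \<inter> set (S j). tau i * completion_time m lam tau S i)"
  proof (rule sum_mono)
    fix j assume j: "j \<in> {1..m}"
    have "(\<Sum>i\<in>A \<inter> set (S j). tau i * completion_time m lam tau S i)
      = (\<Sum>i\<in>A \<inter> set (S j). tau i
          * (2 / lam j + (\<Sum>k\<leftarrow>takeWhile (\<lambda>k. k \<noteq> i) (S j). tau k) + tau i))"
      using j by (intro sum.cong) (auto simp: completion_time_eq[OF dj j])
    then show "((2 / lam j + (\<Sum>i\<in>A \<inter> set (S j). tau i))\<^sup>2 - (2 / lam j)\<^sup>2
        + (\<Sum>i\<in>A \<inter> set (S j). (tau i)\<^sup>2)) / 2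
      \<le> (\<Sum>i\<in>A \<inter> set (S j). tau i * completion_time m lam tau S i)"
      using sum_tau_finish_times_ge[OF dist[OF j] pos[OF j]] by simp
  qed
  also have "\<dots> = (\<Sum>i\<in>A. tau i * completion_time m lam tau S i)"
    by (rule sum_over_workers[OF dj A, symmetric])
  finally show ?thesis .
qed

section \<open>Workloads and prefixes of an LRF run\<close>

lemma lrf_run_workload:
  assumes "lrf_run m lam tau xs S EW"
  shows "EW j = 2 / lam j + (\<Sum>k\<leftarrow>S j. tau k)"
  using assms by (induction arbitrary: j rule: lrf_run.induct) auto

text \<open>The smallest workload never decreases during a run, and a worker had the smallest workload
  when it received its last task.\<close>

lemma lrf_run_last_task:
  assumes "lrf_run m lam tau xs S EW" "\<And>i. i \<in> set xs \<Longrightarrow> 0 \<le> tau i"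
    and "S j \<noteq> []" "k \<in> {1..m}"
  shows "EW j - tau (last (S j)) \<le> EW k"
  using assms
proof (induction arbitrary: j k rule: lrf_run.induct)
  case init
  then show ?case by simp
next
  case (assign xs S EW l i)
  have min: "EW l \<le> EW k" if "k \<in> {1..m}" for k
    using assign.hyps(2) that by (auto simp: is_arg_min_linorder)
  have i: "0 \<le> tau i" using assign.prems by simp
  show ?case
  proof (cases "j = l")
    case True
    then show ?thesis using min[OF assign.prems(3)] i by auto
  next
    case False
    then have "EW j - tau (last (S j)) \<le> EW k" using assign by auto
    then show ?thesis using False i by auto
  qed
qed

text \<open>Later tasks are only appended behind earlier ones, so stopping early leaves the
  completion times of the treated tasks as they are. This makes the greedy bounds available for
  every prefix of the ratio order.\<close>

lemma lrf_run_prefix: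
  assumes "lrf_run m lam tau (ys @ zs) S EW" "distinct (ys @ zs)"
  shows "\<exists>S' EW'. lrf_run m lam tau ys S' EW' \<and>
    (\<forall>i\<in>set ys. completion_time m lam tau S' i = completion_time m lam tau S i)"
  using assms
proof (induction zs arbitrary: S EW rule: rev_induct)
  case Nil
  then show ?case by auto
next
  case (snoc z zs)
  from snoc.prems(1) obtain S0 EW0 l where run: "lrf_run m lam tau (ys @ zs) S0 EW0"
    and S: "S = S0(l := S0 l @ [z])"
    by (cases rule: lrf_run.cases) (auto simp flip: append_assoc)
  have dz: "distinct (ys @ zs)" using snoc.prems(2) by simp
  note inv0 = lrf_run_invariant[OF run dz]
  note inv1 = lrf_run_invariant[OF snoc.prems(1,2)]
  have "completion_time m lam tau S0 i = completion_time m lam tau S i" if i: "i \<in> set ys" for i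
  proof -
    have "i \<in> (\<Union>j\<in>{1..m}. set (S0 j))" using inv0 i by simp
    then obtain j where j: "j \<in> {1..m}" "i \<in> set (S0 j)" by blast
    have "i \<in> set (S j)" using j by (cases "j = l") (auto simp: S)
    moreover have "takeWhile (\<lambda>k. k \<noteq> i) (S j) = takeWhile (\<lambda>k. k \<noteq> i) (S0 j)"
      using takeWhile_append1[OF j(2), of "\<lambda>k. k \<noteq> i" "[z]"] by (cases "j = l") (auto simp: S)
    ultimately show ?thesis
      using j inv0 inv1 completion_time_eq[of S0 m j i] completion_time_eq[of S m j i] by simp
  qed
  with snoc.IH[OF run dz] show ?case by auto
qed

text \<open>Equality holds here because the run has placed no task outside
  \<open>set xs\<close>.\<close>

lemma lrf_run_sum_tau_completion:
  assumes run: "lrf_run m lam tau xs S EW" and "distinct xs"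
  shows "(\<Sum>i\<in>set xs. tau i * completion_time m lam tau S i)
    = ((\<Sum>j\<in>{1..m}. (EW j)\<^sup>2 - (2 / lam j)\<^sup>2) + (\<Sum>i\<in>set xs. (tau i)\<^sup>2)) / 2"
proof -
  note inv = lrf_run_invariant[OF assms]
  have dj: "disjoint_family_on (\<lambda>j. set (S j)) {1..m}" using inv by simp
  have A: "set xs \<subseteq> (\<Union>j\<in>{1..m}. set (S j))" using inv by simp
  have sub: "set xs \<inter> set (S j) = set (S j)" if "j \<in> {1..m}" for j using inv that by auto
  have "(\<Sum>i\<in>set xs. tau i * completion_time m lam tau S i)
    = (\<Sum>j\<in>{1..m}. \<Sum>i\<in>set (S j). tau i * completion_time m lam tau S i)"
    by (simp add: sum_over_workers[OF dj A] sub)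
  also have "\<dots> = (\<Sum>j\<in>{1..m}. ((EW j)\<^sup>2 - (2 / lam j)\<^sup>2 + (\<Sum>i\<in>set (S j). (tau i)\<^sup>2)) / 2)"
  proof (rule sum.cong)
    fix j assume j: "j \<in> {1..m}"
    have d: "distinct (S j)" using inv by simp
    have "(\<Sum>i\<in>set (S j). tau i * completion_time m lam tau S i)
      = (\<Sum>i\<in>set (S j). tau i
          * (2 / lam j + (\<Sum>k\<leftarrow>takeWhile (\<lambda>k. k \<noteq> i) (S j). tau k) + tau i))"
      by (intro sum.cong) (auto simp: completion_time_eq[OF dj j])
    then show "(\<Sum>i\<in>set (S j). tau i * completion_time m lam tau S i)
      = ((EW j)\<^sup>2 - (2 / lam j)\<^sup>2 + (\<Sum>i\<in>set (S j). (tau i)\<^sup>2)) / 2"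
      using lrf_run_workload[OF run, of j]
      by (simp only: sum_tau_finish_times[OF d] sum_list_distinct_conv_sum_set[OF d])
  qed simp
  also have "\<dots> = ((\<Sum>j\<in>{1..m}. (EW j)\<^sup>2 - (2 / lam j)\<^sup>2) + (\<Sum>i\<in>set xs. (tau i)\<^sup>2)) / 2"
    by (simp add: sum_over_workers[OF dj A] sub sum.distrib flip: sum_divide_distrib)
  finally show ?thesis .
qed

lemma lrf_run_sum_power2_workload_le:
  assumes run: "lrf_run m lam tau xs S EW" and dist: "distinct xs" and m: "m \<ge> 1"
    and pos: "\<And>i. i \<in> set xs \<Longrightarrow> 0 \<le> tau i"
    and y: "\<And>j. j \<in> {1..m} \<Longrightarrow> 2 / lam j \<le> y j"
    and tot: "(\<Sum>j\<in>{1..m}. y j) = (\<Sum>j\<in>{1..m}. 2 / lam j) + (\<Sum>i\<in>set xs. tau i)"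
  shows "(\<Sum>j\<in>{1..m}. (EW j)\<^sup>2)
    \<le> (\<Sum>j\<in>{1..m}. (y j)\<^sup>2) + (1 - 1 / real m) * (\<Sum>i\<in>set xs. (tau i)\<^sup>2)"
proof -
  note inv = lrf_run_invariant[OF run dist]
  have dj: "disjoint_family_on (\<lambda>j. set (S j)) {1..m}" using inv by simp
  have A: "set xs \<subseteq> (\<Union>j\<in>{1..m}. set (S j))" using inv by simp
  have sub: "set xs \<inter> set (S j) = set (S j)" if "j \<in> {1..m}" for j using inv that by auto
  have EW: "EW j = 2 / lam j + (\<Sum>i\<in>set (S j). tau i)" for j
    using lrf_run_workload[OF run, of j] inv by (simp add: sum_list_distinct_conv_sum_set)
  \<comment> \<open>A worker outside \<open>B\<close> still has its initial workload
    \<open>2 / lam j\<close>, which is at most \<open>y j\<close>; on \<open>B\<close> the slack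
    \<open>p j\<close> is the last task received.\<close>
  define B where "B = {j \<in> {1..m}. S j \<noteq> []}"
  obtain k where k: "is_arg_min EW (\<lambda>k. k \<in> {1..m}) k"
    using ex_is_arg_min_if_finite[of "{1..m}" EW] m by auto
  have "(\<Sum>j\<in>{1..m}. (EW j)\<^sup>2)
    \<le> (\<Sum>j\<in>{1..m}. (y j)\<^sup>2) + (1 - 1 / real (card {1..m})) * (\<Sum>j\<in>B. (tau (last (S j)))\<^sup>2)"
  proof (rule sum_power2_near_balanced[where k = k])
    show "(\<Sum>j\<in>{1..m}. EW j) = (\<Sum>j\<in>{1..m}. y j)"
      unfolding tot by (simp add: EW sum.distrib sum_over_workers[OF dj A] sub)
    show "EW j - tau (last (S j)) \<le> EW k" if "j \<in> B" for j
      using lrf_run_last_task[OF run pos] that k by (auto simp: B_def is_arg_min_linorder)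
    show "EW j \<le> y j" if "j \<in> {1..m} - B" for j
      using that y[of j] by (auto simp: B_def EW)
  qed (use k in \<open>auto simp: B_def is_arg_min_linorder\<close>)
  moreover have "(\<Sum>j\<in>B. (tau (last (S j)))\<^sup>2) \<le> (\<Sum>i\<in>set xs. (tau i)\<^sup>2)"
  proof -
    \<comment> \<open>The last tasks of different workers are different tasks, so their squares form
      part of the full sum.\<close>
    have "(\<Sum>j\<in>B. (tau (last (S j)))\<^sup>2) \<le> (\<Sum>j\<in>B. \<Sum>i\<in>set (S j). (tau i)\<^sup>2)"
      by (intro sum_mono member_le_sum) (auto simp: B_def)
    also have "\<dots> \<le> (\<Sum>j\<in>{1..m}. \<Sum>i\<in>set (S j). (tau i)\<^sup>2)"
      by (intro sum_mono2) (auto simp: B_def intro: sum_nonneg)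
    also have "\<dots> = (\<Sum>i\<in>set xs. (tau i)\<^sup>2)" by (simp add: sum_over_workers[OF dj A] sub)
    finally show ?thesis .
  qed
  then have "(1 - 1 / real m) * (\<Sum>j\<in>B. (tau (last (S j)))\<^sup>2)
      \<le> (1 - 1 / real m) * (\<Sum>i\<in>set xs. (tau i)\<^sup>2)"
    using m by (intro mult_left_mono) auto
  ultimately show ?thesis by simp
qed

section \<open>Comparison of LRF with an arbitrary schedule\<close>

text \<open>The terms \<open>(2 / lam j)^2\<close> and \<open>(tau i)^2\<close> are the same in the
  formula for LRF and in the lower bound for \<open>T\<close>. They cancel, leaving half the
  difference of the sums of squared workloads.\<close>

lemma lrf_run_sum_tau_completion_le:
  assumes run: "lrf_run m lam tau xs S EW" and dist: "distinct xs" and m: "m \<ge> 1"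
    and xs: "set xs \<subseteq> {1..n}" and pos: "\<And>i. i \<in> {1..n} \<Longrightarrow> 0 \<le> tau i"
    and T: "T \<in> schedules m n"
  shows "(\<Sum>i\<in>set xs. tau i * completion_time m lam tau S i)
    \<le> (\<Sum>i\<in>set xs. tau i * completion_time m lam tau T i)
      + (1 - 1 / real m) / 2 * (\<Sum>i\<in>set xs. (tau i)\<^sup>2)"
proof -
  \<comment> \<open>The workload of \<open>T\<close> once the tasks not yet treated by LRF are
    deleted; its total agrees with that of \<open>EW\<close>.\<close>
  define y where "y j = 2 / lam j + (\<Sum>i\<in>set xs \<inter> set (T j). tau i)" for j
  have dj: "disjoint_family_on (\<lambda>j. set (T j)) {1..m}"
    and un: "(\<Union>j\<in>{1..m}. set (T j)) = {1..n}"
    and dT: "\<And>j. j \<in> {1..m} \<Longrightarrow> distinct (T j)"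
    using T by (auto simp: schedules_def)
  have A: "set xs \<subseteq> (\<Union>j\<in>{1..m}. set (T j))" using un xs by simp
  have "((\<Sum>j\<in>{1..m}. (y j)\<^sup>2 - (2 / lam j)\<^sup>2) + (\<Sum>i\<in>set xs. (tau i)\<^sup>2)) / 2
    \<le> (\<Sum>i\<in>set xs. tau i * completion_time m lam tau T i)"
    unfolding y_def
  proof (rule schedule_sum_tau_completion_ge[OF dj A dT])
    show "0 \<le> tau k" if "j \<in> {1..m}" "k \<in> set (T j)" for j k
      using un that pos[of k] by blast
  qed
  moreover have "(\<Sum>j\<in>{1..m}. (EW j)\<^sup>2)
    \<le> (\<Sum>j\<in>{1..m}. (y j)\<^sup>2) + (1 - 1 / real m) * (\<Sum>i\<in>set xs. (tau i)\<^sup>2)"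
  proof (rule lrf_run_sum_power2_workload_le[OF run dist m])
    show "2 / lam j \<le> y j" for j
      using xs pos by (auto simp: y_def intro!: sum_nonneg)
    show "(\<Sum>j\<in>{1..m}. y j) = (\<Sum>j\<in>{1..m}. 2 / lam j) + (\<Sum>i\<in>set xs. tau i)"
      by (simp add: y_def sum.distrib sum_over_workers[OF dj A])
  qed (use xs pos in auto)
  ultimately show ?thesis
    unfolding lrf_run_sum_tau_completion[OF run dist] by (simp add: sum_subtractf field_simps)
qed

text \<open>Turns the additive error, a multiple of \<open>\<Sum> w tau\<close>, into a multiple of
  the cost of \<open>T\<close>.\<close>

lemma completion_time_ge:
  assumes T: "T \<in> schedules m n" and i: "i \<in> {1..n}"
    and lam: "\<And>j. j \<in> {1..m} \<Longrightarrow> lam j > 0" and tau: "\<And>i. i \<in> {1..n} \<Longrightarrow> tau i > 0"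
  shows "tau i \<le> completion_time m lam tau T i"
proof -
  have dj: "disjoint_family_on (\<lambda>j. set (T j)) {1..m}"
    and un: "(\<Union>j\<in>{1..m}. set (T j)) = {1..n}"
    using T by (auto simp: schedules_def)
  from i un obtain j where j: "j \<in> {1..m}" "i \<in> set (T j)" by blast
  have "set (T j) \<subseteq> {1..n}" using un j by blast
  then have "0 \<le> (\<Sum>k\<leftarrow>takeWhile (\<lambda>k. k \<noteq> i) (T j). tau k)"
    using tau by (intro sum_list_nonneg) (force dest: set_takeWhileD)
  then show ?thesis using completion_time_eq[OF dj j] lam[OF j(1)] by simp
qed

lemma lrf_total_weighted_completion_time_le:
  assumes m: "m \<ge> 1"
    and lam: "\<And>j. j \<in> {1..m} \<Longrightarrow> lam j > 0"
    and tau: "\<And>i. i \<in> {1..n} \<Longrightarrow> tau i > 0"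
    and w: "\<And>i. i \<in> {1..n} \<Longrightarrow> w i > 0"
    and S: "lrf_schedule m n lam tau w S" and T: "T \<in> schedules m n"
  shows "total_weighted_completion_time m n lam tau w S
    \<le> (3 / 2 - 1 / (2 * real m)) * total_weighted_completion_time m n lam tau w T"
proof -
  obtain xs EW where dist: "distinct xs" and xs: "set xs = {1..n}"
    and sorted: "sorted_wrt (\<lambda>a b. w a / tau a \<ge> w b / tau b) xs"
    and run: "lrf_run m lam tau xs S EW"
    using S by (auto simp: lrf_schedule_def)
  define c where "c = (1 - 1 / real m) / 2"
  define C where "C = completion_time m lam tau"
  \<comment> \<open>The slack of task \<open>i\<close> in the \<open>tau\<close>-weighted
    comparison; multiplying it by \<open>w i / tau i\<close> restores the weight
    \<open>w i\<close>.\<close>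
  define g where "g i = tau i * C T i + c * (tau i)\<^sup>2 - tau i * C S i" for i
  have c: "0 \<le> c" using m by (simp add: c_def)
  have prefix: "0 \<le> (\<Sum>i\<leftarrow>ys. g i)" if split: "xs = ys @ zs" for ys zs
  proof -
    obtain S' EW' where run': "lrf_run m lam tau ys S' EW'"
      and eq: "\<forall>i\<in>set ys. completion_time m lam tau S' i = completion_time m lam tau S i"
      using lrf_run_prefix[OF run[unfolded split] dist[unfolded split]] by blast
    have d: "distinct ys" and ys: "set ys \<subseteq> {1..n}" using dist split xs by auto
    have "(\<Sum>i\<in>set ys. tau i * C S i) = (\<Sum>i\<in>set ys. tau i * C S' i)"
      using eq by (intro sum.cong) (auto simp: C_def)
    also have "\<dots> \<le> (\<Sum>i\<in>set ys. tau i * C T i) + c * (\<Sum>i\<in>set ys. (tau i)\<^sup>2)"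
      unfolding C_def c_def
      by (intro lrf_run_sum_tau_completion_le[OF run' d m ys _ T] less_imp_le tau)
    finally show ?thesis
      using d by (simp add: sum_list_distinct_conv_sum_set g_def sum.distrib sum_subtractf sum_distrib_left)
  qed
  \<comment> \<open>The factor 0 is the lower bound \<open>c\<close> for the ratios in the summation
    by parts.\<close>
  have "0 * (\<Sum>i\<leftarrow>xs. g i) \<le> (\<Sum>i\<leftarrow>xs. w i / tau i * g i)"
    using sorted prefix tau w xs
    by (intro weighted_sum_nonneg_of_prefix_sums) (auto simp: less_imp_le)
  also have "\<dots> = (\<Sum>i=1..n. w i * C T i + c * (w i * tau i) - w i * C S i)"
    unfolding sum_list_distinct_conv_sum_set[OF dist] xs
  proof (rule sum.cong)
    show "w i / tau i * g i = w i * C T i + c * (w i * tau i) - w i * C S i" if "i \<in> {1..n}" for i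
      using tau[OF that] by (simp add: g_def field_simps power2_eq_square)
  qed simp
  also have "\<dots> \<le> (\<Sum>i=1..n. w i * C T i + c * (w i * C T i) - w i * C S i)"
  proof (intro sum_mono diff_right_mono add_left_mono mult_left_mono c)
    show "tau i \<le> C T i" if "i \<in> {1..n}" for i
      unfolding C_def using T that lam tau by (rule completion_time_ge)
    show "0 \<le> w i" if "i \<in> {1..n}" for i
      using w[OF that] by simp
  qed
  also have "\<dots> = (1 + c) * total_weighted_completion_time m n lam tau w T
      - total_weighted_completion_time m n lam tau w S"
    by (simp add: total_weighted_completion_time_def C_def sum.distrib sum_subtractf
        sum_distrib_left distrib_right)
  finally show ?thesis by (simp add: c_def diff_divide_distrib mult.commute)
qed

theorem theorem3:
  fixes m n :: nat
    and lam tau w :: "nat \<Rightarrow> real"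
    and S :: "nat \<Rightarrow> nat list"
  assumes "m \<ge> 1"
    and "\<And>j. j \<in> {1..m} \<Longrightarrow> lam j > 0"
    and "\<And>i. i \<in> {1..n} \<Longrightarrow> tau i > 0"
    and "\<And>i. i \<in> {1..n} \<Longrightarrow> w i > 0"
    and "Min (tau ` {1..n}) > 2 / Max (lam ` {1..m})"
    and "n \<ge> m"
    and "lrf_schedule m n lam tau w S"
  shows "total_weighted_completion_time m n lam tau w S
    \<le> (2 - 1 / real m) * min_total_weighted_completion_time m n lam tau w"
proof -
  have "min_total_weighted_completion_time m n lam tau w
      \<in> total_weighted_completion_time m n lam tau w ` schedules m n"
    unfolding min_total_weighted_completion_time_def
    using finite_schedules schedules_nonempty[OF assms(1)] by (intro Min_in) auto
  then obtain T where T: "T \<in> schedules m n"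
    and opt: "min_total_weighted_completion_time m n lam tau w
      = total_weighted_completion_time m n lam tau w T" by auto
  \<comment> \<open>The optimum must be nonnegative for the factor \<open>3/2 - 1/(2m)\<close> to be
    raised to \<open>2 - 1/m\<close>.\<close>
  have "0 \<le> w i * completion_time m lam tau T i" if i: "i \<in> {1..n}" for i
  proof -
    have "tau i \<le> completion_time m lam tau T i"
      using T i assms(2,3) by (rule completion_time_ge)
    then show ?thesis using assms(3,4)[OF i] by simp
  qed
  then have "0 \<le> total_weighted_completion_time m n lam tau w T"
    unfolding total_weighted_completion_time_def by (rule sum_nonneg)
  moreover have "3 / 2 - 1 / (2 * real m) \<le> 2 - 1 / real m"
    using assms(1) by (simp add: field_simps)
  ultimately show ?thesis
    unfolding opt
    using lrf_total_weighted_completion_time_le[OF assms(1-4,7) T] mult_right_mono by fastforce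
qed

end
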